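(* For every atomic base $\mathfrak{B}$, every finite set of formulas $\Gamma$ and every formula $A$: $\Gamma \models_{\mathfrak{B}} A \Longleftrightarrow \Gamma \models^{\alpha}_{\mathfrak{B}} A$, where $\models_{\mathfrak{B}}$ is consequence over $\mathfrak{B}$ in non-monotonic standard base semantics and $\models^{\alpha}_{\mathfrak{B}}$ is consequence over $\mathfrak{B}$ in non-monotonic reducibility semantics.
   Context: **Language.** Formulas: $X ::= p, q, r, s, t, \ldots \mid \bot \mid X \wedge X \mid X \vee X \mid X \rightarrow X$, with $\neg X := X \rightarrow \bot$. Atomic formulas (atoms) are the propositional variables and $\bot$ (an atomic constant for absurdity). $\Gamma$ always denotes a finite set of formulas. **Atomic bases.** Every atom is an atomic rule of level $0$. Given atoms $A_1,\ldots,A_n$ and (possibly empty) finite sets of atomic rules $\mathfrak{C}_1,\ldots,\mathfrak{C}_n$, where the rules "from $\mathfrak{C}_i$ infer $A_i$" have maximal level $k-1$ (if $\mathfrak{C}_i=\emptyset$, this is just the atom $A_i$, of level $0$), and given an atom $A$, the rule with premises $A_1,\ldots,A_n$, conclusion $A$, and discharging $\mathfrak{C}_i$ above the $i$-th premise, is an atomic rule of level $k$. An atomic base of level $k$ is a set of atomic rules of maximal level $k$; there is no upper bound on the admitted levels $k$. Derivations are the usual natural deduction trees: an atom $A$ is derivable from a set of rules $\mathfrak{S}$ when some rule in $\mathfrak{S}$ has conclusion $A$ and each premise $A_i$ of it is derivable from $\mathfrak{S} \cup \mathfrak{C}_i$, $\mathfrak{C}_i$ being the set of rules discharged at that premise (an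 atom in $\mathfrak{S}$ is derivable outright). $\mathrm{DER}_{\mathfrak{B}}$ is the set of derivations over $\mathfrak{B}$, and $\vdash_{\mathfrak{B}} A$ means that $A$ is derivable from $\mathfrak{B}$. All atomic bases $\mathfrak{B}$ are assumed consistent: $\not\vdash_{\mathfrak{B}} \bot$. **Standard base semantics.** $\Gamma \models_{\mathfrak{B}} A$ is defined by: if $\Gamma = \emptyset$, then for $A$ atomic, $\models_{\mathfrak{B}} A$ iff $\vdash_{\mathfrak{B}} A$; $\models_{\mathfrak{B}} B \wedge C$ iff $\models_{\mathfrak{B}} B$ and $\models_{\mathfrak{B}} C$; $\models_{\mathfrak{B}} B \vee C$ iff $\models_{\mathfrak{B}} B$ or $\models_{\mathfrak{B}} C$; $\models_{\mathfrak{B}} B \rightarrow C$ iff $B \models_{\mathfrak{B}} C$. If $\Gamma \neq \emptyset$, then $\Gamma \models_{\mathfrak{B}} A$ iff ($\models_{\mathfrak{B}} B$ for all $B \in \Gamma$ implies $\models_{\mathfrak{B}} A$). **Reducibility semantics.** An *argument structure* is a pair $\mathscr{D} = \langle T, f\rangle$ where $T$ is a finite rooted tree with order relation $\omega$, with nodes labelled by formulas and top-nodes partitioned into axiomatic and non-axiomatic ones; $f$ is a discharge function, mapping onto lower nodes elements of (a) a subset of the non-axiomatic top-nodes, (b) a subset of the axiomatic top-nodes labelled by atoms, (c) a subset of $\wp(\omega)$, each element of which contains only the pairs linking a node labelled by an atom to all its children, labelled by atoms too, with no non-axiomatic top-node mapped by $f$ onto such a maximal node or onto the image of the latter under $f$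 (so $f$ indicates where assumptions, atomic axioms and atomic rules are discharged). The non-axiomatic top-nodes are the assumptions, the root is the conclusion. $\mathscr{D}$ is *closed* if the domain of $f$ contains all non-axiomatic top-nodes, otherwise *open*; it is *from* $\Gamma$ *to* (or *for* ) $A$ when $\Gamma$ is its set of undischarged assumptions and $A$ its conclusion. (Immediate) sub-structures, and the replacement $\mathscr{D}[\mathscr{D}^{**}/\mathscr{D}^{*}]$ of a sub-structure $\mathscr{D}^{*}$ by $\mathscr{D}^{**}$, are defined as usual. If $\mathscr{D}$ is from $\{A_1,\ldots,A_n\}$ to $A$ and $\sigma$ maps formulas to argument structures so that $\sigma(A_i)$ is a (closed) argument structure for $A_i$, then $\mathscr{D}^{\sigma} = \mathscr{D}[\sigma(A_1),\ldots,\sigma(A_n)/A_1,\ldots,A_n]$ is a (closed) *instance* of $\mathscr{D}$. An *inference* is a triple $\langle\langle \mathscr{D}_1,\ldots,\mathscr{D}_n\rangle, A, \delta\rangle$ ($n \ge 0$) with $\delta$ an extension of the discharge functions of the $\mathscr{D}_i$; its associated argument structure joins the trees of the $\mathscr{D}_i$ by a new root $A$, with discharges as given by $\delta$. An *inference rule* is a set of inferences. $\mathscr{D}$ is *canonical* iff it is associated to an instance of one of Gentzen's introduction rules for $\wedge,\vee,\rightarrow$. A *reduction* for a rule $R$ is a function $\phi$ from and to argument structures, defined on some subset $\mathbb{D}$ of $R$, such that for every $\mathscr{D}$ associated to an element of $\mathbb{D}$ and every $\sigma$: (1) the instance of $R$ to which $\mathscr{D}^{\sigma}$ is associated is in $\mathbb{D}$;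 (2) $\phi$ is defined on $\mathscr{D}^{\sigma}$ and $\phi(\mathscr{D}^{\sigma}) = \phi(\mathscr{D})^{\sigma}$; (3) if $\mathscr{D}$ is from $\Gamma$ to $A$, then $\phi(\mathscr{D})$ is from some $\Gamma^{*} \subseteq \Gamma$ to $A$. No constructivity or schematicity restriction is put on reductions. $\mathfrak{J}$ denotes a set of reductions; an extension of it is any set of reductions $\mathfrak{J}^{+} \supseteq \mathfrak{J}$. $\mathscr{D}$ *immediately reduces* to $\mathscr{D}^{*}$ via $\mathfrak{J}$ iff for some sub-structure $\mathscr{D}^{**}$ of $\mathscr{D}$ and some $\phi \in \mathfrak{J}$, $\mathscr{D}^{*} = \mathscr{D}[\phi(\mathscr{D}^{**})/\mathscr{D}^{**}]$; $\leq_{\mathfrak{J}}$ is the reflexive-transitive closure of this relation. An *argument* is a pair $\langle \mathscr{D}, \mathfrak{J}\rangle$, closed or open as $\mathscr{D}$ is. *Validity on* $\mathfrak{B}$ of $\langle \mathscr{D}, \mathfrak{J}\rangle$: if $\mathscr{D}$ is closed with atomic conclusion, it is valid iff $\mathscr{D} \leq_{\mathfrak{J}} \mathscr{D}^{*}$ for some $\mathscr{D}^{*} = \langle T,f\rangle$ with $T \in \mathrm{DER}_{\mathfrak{B}}$; if $\mathscr{D}$ is closed with non-atomic conclusion, it is valid iff $\mathscr{D} \leq_{\mathfrak{J}} \mathscr{D}^{*}$ for some canonical $\mathscr{D}^{*}$ whose immediate sub-structures are valid on $\mathfrak{B}$ when paired with $\mathfrak{J}$; if $\mathscr{D}$ is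 open with undischarged assumptions $A_1,\ldots,A_n$, it is valid iff for every $\sigma$ and every extension $\mathfrak{J}^{+}$ of $\mathfrak{J}$, if each $\langle \sigma(A_i), \mathfrak{J}^{+}\rangle$ ($i \le n$) is closed and valid on $\mathfrak{B}$, then $\langle \mathscr{D}^{\sigma}, \mathfrak{J}^{+}\rangle$ is valid on $\mathfrak{B}$. $\Gamma \models^{\alpha}_{\mathfrak{B}} A$ iff there is an argument $\langle \mathscr{D}, \mathfrak{J}\rangle$ from $\Gamma$ to $A$ valid on $\mathfrak{B}$. *)

theory Defs
  imports "HOL-Library.FSet"
begin

section \<open>Formulas and atomic bases\<close>

datatype 'v atom = Var 'v | Falsum

datatype 'v fm = Atom "'v atom" | And "'v fm" "'v fm" | Or "'v fm" "'v fm" | Imp "'v fm" "'v fm"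

abbreviation Neg :: "'v fm \<Rightarrow> 'v fm" where
  "Neg A \<equiv> Imp A (Atom Falsum)"

text \<open>\<open>Rule [(C1, A1), \<dots>, (Cn, An)] A\<close> is the rule with premises \<open>A1, \<dots>, An\<close> and conclusion \<open>A\<close>
  that discharges the rules \<open>Ci\<close> above the \<open>i\<close>-th premise. An atom \<open>A\<close>, regarded as a rule of
  level 0, is \<open>Rule [] A\<close>.\<close>

datatype 'v arule = Rule "('v arule fset \<times> 'v atom) list" "'v atom"

text \<open>\<open>premise_level (K, A)\<close> is the level of ``from \<open>C\<close> infer \<open>A\<close>'', where \<open>K\<close> is the set of
  levels of the rules in \<open>C\<close>.\<close>

definition premise_level :: "nat fset \<times> 'v atom \<Rightarrow> nat" where
  "premise_level p = (if fst p = {||} then 0 else Suc (Max (fset (fst p))))"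

primrec level :: "'v arule \<Rightarrow> nat" where
  "level (Rule ps a) =
     (if ps = [] then 0 else Suc (Max (premise_level ` set (map (map_prod (fimage level) id) ps))))"

inductive derivable :: "'v arule set \<Rightarrow> 'v atom \<Rightarrow> bool" where
  "Rule ps a \<in> \<SS> \<Longrightarrow> (\<And>C b. (C, b) \<in> set ps \<Longrightarrow> derivable (\<SS> \<union> fset C) b) \<Longrightarrow> derivable \<SS> a"

definition base_of_level :: "nat \<Rightarrow> 'v arule set \<Rightarrow> bool" where
  "base_of_level k \<BB> \<longleftrightarrow> (\<forall>r\<in>\<BB>. level r \<le> k)"

definition atomic_base :: "'v arule set \<Rightarrow> bool" where
  "atomic_base \<BB> \<longleftrightarrow> (\<exists>k. base_of_level k \<BB>) \<and> \<not> derivable \<BB> Falsum"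


section \<open>Standard base semantics\<close>

text \<open>The right-hand side of the clause for implication is consequence of \<open>C\<close> from the nonempty set \<open>{B}\<close>.\<close>

primrec base_sat :: "'v arule set \<Rightarrow> 'v fm \<Rightarrow> bool" where
  "base_sat \<BB> (Atom a) \<longleftrightarrow> derivable \<BB> a"
| "base_sat \<BB> (And B C) \<longleftrightarrow> base_sat \<BB> B \<and> base_sat \<BB> C"
| "base_sat \<BB> (Or B C) \<longleftrightarrow> base_sat \<BB> B \<or> base_sat \<BB> C"
| "base_sat \<BB> (Imp B C) \<longleftrightarrow> (base_sat \<BB> B \<longrightarrow> base_sat \<BB> C)"

definition base_conseq :: "'v arule set \<Rightarrow> 'v fm set \<Rightarrow> 'v fm \<Rightarrow> bool" where
  "base_conseq \<BB> \<Gamma> A \<longleftrightarrow>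
     (if \<Gamma> = {} then base_sat \<BB> A else ((\<forall>B\<in>\<Gamma>. base_sat \<BB> B) \<longrightarrow> base_sat \<BB> A))"


section \<open>Argument structures\<close>

text \<open>
  A pair \<open>\<langle>T, f\<rangle>\<close> is encoded as one tree. \<open>Asm A d\<close> is a non-axiomatic top-node, \<open>Node A d []\<close> an
  axiomatic top-node, and \<open>Node A d ts\<close> with \<open>ts \<noteq> []\<close> an inner node. The field \<open>d\<close> is the value of
  the discharge function: \<open>None\<close> means that the item is not in its domain, and \<open>Some k\<close> that it is
  mapped onto the proper ancestor \<open>k + 1\<close> steps below (\<open>Some 0\<close> is the parent). At an inner node,
  \<open>d\<close> is the value of \<open>f\<close> on the set of all edges from that node to its children, which determines
  and is determined by the node.

  Functions with a numerical argument \<open>n\<close> are applied to a subtree whose root is \<open>n\<close> steps above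
  the root of the structure under consideration, so that \<open>d = Some k\<close> at that root stays inside
  the structure iff \<open>k < n\<close>.
\<close>

datatype 'v astruct = Asm "'v fm" "nat option" | Node "'v fm" "nat option" "'v astruct list"

fun concl :: "'v astruct \<Rightarrow> 'v fm" where
  "concl (Asm A d) = A"
| "concl (Node A d ts) = A"

text \<open>\<open>asm_mapped k t\<close>: some assumption of \<open>t\<close> is mapped onto the node \<open>k + 1\<close> steps below the
  root of \<open>t\<close>.\<close>

fun asm_mapped :: "nat \<Rightarrow> 'v astruct \<Rightarrow> bool" where
  "asm_mapped k (Asm A d) \<longleftrightarrow> d = Some k"
| "asm_mapped k (Node A d ts) \<longleftrightarrow> (\<exists>t\<in>set ts. asm_mapped (Suc k) t)"

text \<open>The first argument lists, from the parent downwards, for each node below whether some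
  assumption is mapped onto it. A discharged application of an atomic rule must be labelled by
  atoms, and no assumption may be mapped onto it or onto the node it is mapped onto.\<close>

fun wf_struct :: "bool list \<Rightarrow> 'v astruct \<Rightarrow> bool" where
  "wf_struct hs (Asm A d) \<longleftrightarrow> (\<forall>k. d = Some k \<longrightarrow> k < length hs)"
| "wf_struct hs (Node A d ts) \<longleftrightarrow>
     (let h = (\<exists>t\<in>set ts. asm_mapped 0 t) in
       (\<forall>k. d = Some k \<longrightarrow>
          k < length hs \<and> A \<in> range Atom \<and> (\<forall>t\<in>set ts. concl t \<in> range Atom) \<and>
          (ts \<noteq> [] \<longrightarrow> \<not> h \<and> \<not> hs ! k)) \<and>
       (\<forall>t\<in>set ts. wf_struct (h # hs) t))"

definition arg_struct :: "'v astruct \<Rightarrow> bool" where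
  "arg_struct D \<longleftrightarrow> wf_struct [] D"

fun open_asms :: "'v astruct \<Rightarrow> 'v fm set" where
  "open_asms (Asm A d) = (if d = None then {A} else {})"
| "open_asms (Node A d ts) = (\<Union>t\<in>set ts. open_asms t)"

definition closed_struct :: "'v astruct \<Rightarrow> bool" where
  "closed_struct D \<longleftrightarrow> open_asms D = {}"

text \<open>The sub-structure of a structure given by a subtree \<open>t\<close> is \<open>sub_struct 0 t\<close>: items mapped
  onto nodes outside \<open>t\<close> become undischarged.\<close>

fun sub_struct :: "nat \<Rightarrow> 'v astruct \<Rightarrow> 'v astruct" where
  "sub_struct n (Asm A d) =
     Asm A (case d of None \<Rightarrow> None | Some k \<Rightarrow> if k < n then Some k else None)"
| "sub_struct n (Node A d ts) =
     Node A (case d of None \<Rightarrow> None | Some k \<Rightarrow> if k < n then Some k else None)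
       (map (sub_struct (Suc n)) ts)"

fun immediate_subs :: "'v astruct \<Rightarrow> 'v astruct list" where
  "immediate_subs (Asm A d) = []"
| "immediate_subs (Node A d ts) = map (sub_struct 0) ts"

fun subst :: "('v fm \<Rightarrow> 'v astruct) \<Rightarrow> 'v astruct \<Rightarrow> 'v astruct" where
  "subst \<sigma> (Asm A d) = (if d = None then \<sigma> A else Asm A d)"
| "subst \<sigma> (Node A d ts) = Node A d (map (subst \<sigma>) ts)"

definition is_subst :: "('v fm \<Rightarrow> 'v astruct) \<Rightarrow> bool" where
  "is_subst \<sigma> \<longleftrightarrow> (\<forall>A. arg_struct (\<sigma> A) \<and> concl (\<sigma> A) = A)"

text \<open>
  Replacement of a sub-structure \<open>S\<close> by \<open>E\<close>. If \<open>S\<close> lies inside a larger structure, some of its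
  undischarged assumptions may be discharged there below \<open>S\<close>; those of \<open>E\<close> have to be discharged
  correspondingly. \<open>outer_asms 0 t\<close> lists, for the assumptions of the subtree \<open>t\<close> that are not
  discharged within \<open>t\<close>, the formula and the node outside \<open>t\<close> onto which it is mapped (\<open>None\<close> if
  there is none); \<open>outer_rules 0 t\<close> does the same for the atomic axioms and the applications of
  atomic rules, identified by their conclusion and premises, that are discharged outside \<open>t\<close>.
  Each assumption of \<open>E\<close> gets the outer value of some assumption of \<open>S\<close> with the same formula;
  each atomic rule item of \<open>E\<close> that gets an outer value gets that of an item of \<open>S\<close> of the same
  form. If \<open>S\<close> has several suitable values, each of them gives a result of the replacement.
\<close>

fun outer_asms :: "nat \<Rightarrow> 'v astruct \<Rightarrow> ('v fm \<times> nat option) set" where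
  "outer_asms n (Asm A d) =
     (case d of None \<Rightarrow> {(A, None)} | Some k \<Rightarrow> if k < n then {} else {(A, Some (k - n))})"
| "outer_asms n (Node A d ts) = (\<Union>t\<in>set ts. outer_asms (Suc n) t)"

fun outer_rules :: "nat \<Rightarrow> 'v astruct \<Rightarrow> (('v fm \<times> 'v fm list) \<times> nat) set" where
  "outer_rules n (Asm A d) = {}"
| "outer_rules n (Node A d ts) =
     (case d of None \<Rightarrow> {} | Some k \<Rightarrow> if k < n then {} else {((A, map concl ts), k - n)}) \<union>
     (\<Union>t\<in>set ts. outer_rules (Suc n) t)"

inductive replaced :: "'v astruct \<Rightarrow> 'v astruct \<Rightarrow> 'v astruct \<Rightarrow> 'v astruct \<Rightarrow> bool"
  for S E :: "'v astruct" where
  here: "\<lbrakk>sub_struct 0 t = S; sub_struct 0 t' = E; outer_asms 0 t' \<subseteq> outer_asms 0 t;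
          outer_rules 0 t' \<subseteq> outer_rules 0 t\<rbrakk> \<Longrightarrow> replaced S E t t'"
| above: "replaced S E t t' \<Longrightarrow> replaced S E (Node A d (us @ t # vs)) (Node A d (us @ t' # vs))"


section \<open>Inferences and canonical structures\<close>

text \<open>\<open>discharge_ext D u\<close>: \<open>u\<close> has the same tree as \<open>D\<close>, and its discharge function extends that of
  \<open>D\<close>, possibly onto nodes below the root.\<close>

inductive discharge_ext :: "'v astruct \<Rightarrow> 'v astruct \<Rightarrow> bool" where
  "d = None \<or> d = d' \<Longrightarrow> discharge_ext (Asm A d) (Asm A d')"
| "d = None \<or> d = d' \<Longrightarrow> list_all2 discharge_ext ts us \<Longrightarrow>
     discharge_ext (Node A d ts) (Node A d' us)"

text \<open>An inference \<open>\<langle>\<langle>D1, \<dots>, Dn\<rangle>, A, \<delta>\<rangle>\<close> is represented by \<open>([D1, \<dots>, Dn], A, [u1, \<dots>, un])\<close>, where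
  the tree \<open>ui\<close> is that of \<open>Di\<close> and carries the values of \<open>\<delta>\<close>.\<close>

type_synonym 'v inference = "'v astruct list \<times> 'v fm \<times> 'v astruct list"

definition assoc :: "'v inference \<Rightarrow> 'v astruct" where
  "assoc \<iota> = (case \<iota> of (Ds, A, us) \<Rightarrow> Node A None us)"

definition inferences :: "'v inference set" where
  "inferences = {(Ds, A, us). (\<forall>D\<in>set Ds. arg_struct D) \<and> list_all2 discharge_ext Ds us \<and>
                              arg_struct (Node A None us)}"

text \<open>Gentzen's introduction rules. Those for conjunction and disjunction discharge nothing; that for
  implication may only discharge, at the new root, assumptions of the form of the antecedent
  (possibly none).\<close>

definition and_intro :: "'v inference set" where
  "and_intro = {\<iota> \<in> inferences. \<exists>D1 D2. \<iota> = ([D1, D2], And (concl D1) (concl D2), [D1, D2])}"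

definition or_intro :: "'v inference set" where
  "or_intro = {\<iota> \<in> inferences. \<exists>D A B. \<iota> = ([D], Or A B, [D]) \<and> concl D \<in> {A, B}}"

definition imp_intro :: "'v inference set" where
  "imp_intro = {\<iota> \<in> inferences. \<exists>D A u. \<iota> = ([D], Imp A (concl D), [u]) \<and> sub_struct 0 u = D \<and>
                  outer_asms 0 u \<subseteq> {(A, Some 0)} \<union> UNIV \<times> {None} \<and> outer_rules 0 u = {}}"

definition canonical :: "'v astruct \<Rightarrow> bool" where
  "canonical D \<longleftrightarrow> D \<in> assoc ` (and_intro \<union> or_intro \<union> imp_intro)"


section \<open>Reductions\<close>

definition reduction_for :: "'v inference set \<Rightarrow> ('v astruct \<rightharpoonup> 'v astruct) \<Rightarrow> bool" where
  "reduction_for R \<phi> \<longleftrightarrow> (\<exists>\<DD>\<subseteq>R. dom \<phi> = assoc ` \<DD> \<and>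
     (\<forall>D\<in>assoc ` \<DD>. arg_struct (the (\<phi> D)) \<and>
        open_asms (the (\<phi> D)) \<subseteq> open_asms D \<and> concl (the (\<phi> D)) = concl D \<and>
        (\<forall>\<sigma>. is_subst \<sigma> \<longrightarrow>
           subst \<sigma> D \<in> assoc ` \<DD> \<and> \<phi> (subst \<sigma> D) = Some (subst \<sigma> (the (\<phi> D))))))"

definition is_reduction :: "('v astruct \<rightharpoonup> 'v astruct) \<Rightarrow> bool" where
  "is_reduction \<phi> \<longleftrightarrow> (\<exists>R\<subseteq>inferences. reduction_for R \<phi>)"

typedef 'v reduction = "{\<phi> :: 'v astruct \<rightharpoonup> 'v astruct. is_reduction \<phi>}"
  morphisms apply_red Abs_reduction
proof
  show "Map.empty \<in> {\<phi> :: 'v astruct \<rightharpoonup> 'v astruct. is_reduction \<phi>}"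
    by (auto simp: is_reduction_def reduction_for_def)
qed

definition reduces1 :: "'v reduction set \<Rightarrow> 'v astruct \<Rightarrow> 'v astruct \<Rightarrow> bool" where
  "reduces1 \<JJ> D D' \<longleftrightarrow> arg_struct D' \<and>
     (\<exists>S E. \<exists>\<phi>\<in>\<JJ>. apply_red \<phi> S = Some E \<and> replaced S E D D')"

abbreviation reduces :: "'v reduction set \<Rightarrow> 'v astruct \<Rightarrow> 'v astruct \<Rightarrow> bool" where
  "reduces \<JJ> \<equiv> (reduces1 \<JJ>)\<^sup>*\<^sup>*"


section \<open>Derivations over a base\<close>

text \<open>In \<open>deriv \<BB> \<CC>s D\<close>, \<open>\<CC>s ! k\<close> is the set of rules that may be discharged at the proper
  ancestor \<open>k + 1\<close> steps below the root of \<open>D\<close>, above the relevant premise. Each node applies either a rule of \<open>\<BB>\<close> or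
  a rule discharged at the node onto which the discharge function maps it.\<close>

inductive deriv :: "'v arule set \<Rightarrow> 'v arule set list \<Rightarrow> 'v astruct \<Rightarrow> bool"
  for \<BB> :: "'v arule set" where
  "\<lbrakk>case d of None \<Rightarrow> Rule ps a \<in> \<BB> | Some k \<Rightarrow> k < length \<CC>s \<and> Rule ps a \<in> \<CC>s ! k;
    length ts = length ps;
    \<And>i. i < length ps \<Longrightarrow>
      concl (ts ! i) = Atom (snd (ps ! i)) \<and> deriv \<BB> (fset (fst (ps ! i)) # \<CC>s) (ts ! i)\<rbrakk>
   \<Longrightarrow> deriv \<BB> \<CC>s (Node (Atom a) d ts)"

definition DER :: "'v arule set \<Rightarrow> 'v astruct set" where
  "DER \<BB> = {D. deriv \<BB> [] D}"


section \<open>Validity\<close>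

lemma finite_open_asms [simp]: "finite (open_asms D)"
  by (induction D) auto

lemma open_asms_iff: "A \<in> open_asms t \<longleftrightarrow> (A, None) \<in> outer_asms n t"
  by (induction t arbitrary: n) (auto split: option.splits)

lemma concl_sub_struct [simp]: "concl (sub_struct n t) = concl t"
  by (cases t) auto

lemma open_asms_sub_struct: "open_asms (sub_struct n t) = fst ` outer_asms n t"
  by (induction t arbitrary: n) (auto split: option.splits simp: image_UN)

lemma sub_struct_wf: "wf_struct hs t \<Longrightarrow> sub_struct (length hs) t = t"
proof (induction t arbitrary: hs)
  case (Node A d ts)
  let ?h = "\<exists>t\<in>set ts. asm_mapped 0 t"
  have "sub_struct (Suc (length hs)) t = t" if "t \<in> set ts" for t
    using Node.IH[OF that, of "?h # hs"] Node.prems that by (auto simp: Let_def)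
  then show ?case
    using Node.prems by (auto simp: Let_def map_idI split: option.splits)
qed (auto split: option.splits)

lemma sub_struct_arg_struct: "arg_struct D \<Longrightarrow> sub_struct 0 D = D"
  unfolding arg_struct_def using sub_struct_wf[of "[]" D] by simp

lemma open_asms_subst: "open_asms (subst \<sigma> D) = (\<Union>A\<in>open_asms D. open_asms (\<sigma> A))"
  by (induction D) auto

lemma concl_subst: "is_subst \<sigma> \<Longrightarrow> concl (subst \<sigma> D) = concl D"
  by (cases D) (auto simp: is_subst_def)

lemma apply_red_SomeD:
  assumes "apply_red \<phi> D = Some E"
  shows "concl E = concl D" "open_asms E \<subseteq> open_asms D" "arg_struct E"
proof -
  have "is_reduction (apply_red \<phi>)"
    using apply_red by blast
  then obtain R where "reduction_for R (apply_red \<phi>)"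
    unfolding is_reduction_def by blast
  then obtain \<DD> where \<DD>: "dom (apply_red \<phi>) = assoc ` \<DD>"
      "\<forall>D\<in>assoc ` \<DD>. arg_struct (the (apply_red \<phi> D)) \<and>
        open_asms (the (apply_red \<phi> D)) \<subseteq> open_asms D \<and> concl (the (apply_red \<phi> D)) = concl D \<and>
        (\<forall>\<sigma>. is_subst \<sigma> \<longrightarrow> subst \<sigma> D \<in> assoc ` \<DD> \<and>
           apply_red \<phi> (subst \<sigma> D) = Some (subst \<sigma> (the (apply_red \<phi> D))))"
    unfolding reduction_for_def by (elim exE conjE)
  have "D \<in> assoc ` \<DD>"
    using assms \<DD>(1) by blast
  from bspec[OF \<DD>(2) this] show "concl E = concl D" "open_asms E \<subseteq> open_asms D" "arg_struct E"
    by (simp_all add: assms)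
qed

lemma replaced_preserves:
  "replaced S E t t' \<Longrightarrow> concl E = concl S \<Longrightarrow> concl t' = concl t \<and> open_asms t' \<subseteq> open_asms t"
proof (induction rule: replaced.induct)
  case (here t t')
  then show ?case
    by (metis concl_sub_struct open_asms_iff subset_iff)
qed auto

lemma reduces_preserves:
  assumes "reduces \<JJ> D D'"
  shows "concl D' = concl D" "open_asms D' \<subseteq> open_asms D"
proof -
  have "concl D' = concl D \<and> open_asms D' \<subseteq> open_asms D"
    using assms
  proof (induction rule: rtranclp_induct)
    case (step y z)
    then have "concl z = concl y \<and> open_asms z \<subseteq> open_asms y"
      unfolding reduces1_def using apply_red_SomeD(1) replaced_preserves by blast
    with step.IH show ?case
      by auto
  qed simp
  then show "concl D' = concl D" "open_asms D' \<subseteq> open_asms D"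
    by auto
qed

definition complexity :: "'v astruct \<Rightarrow> nat" where
  "complexity D = Max (size ` insert (concl D) (open_asms D))"

lemma complexity_less:
  assumes "size (concl D) < m" "\<And>A. A \<in> open_asms D \<Longrightarrow> size A < m"
  shows "complexity D < m"
  using assms unfolding complexity_def by (subst Max_less_iff) auto

lemma complexity_closed: "closed_struct D \<Longrightarrow> complexity D = size (concl D)"
  by (simp add: complexity_def closed_struct_def)

lemma size_le_complexity: "A \<in> insert (concl D) (open_asms D) \<Longrightarrow> size A \<le> complexity D"
  unfolding complexity_def by (rule Max_ge) auto

lemma complexity_immediate_sub:
  assumes "canonical D" "closed_struct D" "D' \<in> set (immediate_subs D)"
  shows "complexity D' < complexity D"
proof -
  consider (A) "D \<in> assoc ` and_intro" | (O) "D \<in> assoc ` or_intro" | (I) "D \<in> assoc ` imp_intro"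
    using assms(1) by (auto simp: canonical_def)
  then have "complexity D' < size (concl D)"
  proof cases
    case A
    then obtain D1 D2 where D: "D = Node (And (concl D1) (concl D2)) None [D1, D2]"
        "arg_struct D1" "arg_struct D2"
      by (auto simp: and_intro_def inferences_def assoc_def)
    moreover have "open_asms D1 = {}" "open_asms D2 = {}"
      using assms(2) D(1) by (auto simp: closed_struct_def)
    ultimately show ?thesis
      using assms(3) by (auto simp: sub_struct_arg_struct intro!: complexity_less)
  next
    case O
    then obtain E A B where D: "D = Node (Or A B) None [E]" "arg_struct E" "concl E \<in> {A, B}"
      by (auto simp: or_intro_def inferences_def assoc_def)
    moreover have "open_asms E = {}"
      using assms(2) D(1) by (auto simp: closed_struct_def)
    ultimately show ?thesis
      using assms(3) by (auto simp: sub_struct_arg_struct intro!: complexity_less)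
  next
    case I
    then obtain A u where D: "D = Node (Imp A (concl u)) None [u]"
        "outer_asms 0 u \<subseteq> {(A, Some 0)} \<union> UNIV \<times> {None}"
      by (force simp: imp_intro_def assoc_def)
    moreover have "(B, None) \<notin> outer_asms 0 u" for B
      using assms(2) D(1) open_asms_iff[of B u 0] by (auto simp: closed_struct_def)
    ultimately have "outer_asms 0 u \<subseteq> {(A, Some 0)}"
      by blast
    then have "open_asms (sub_struct 0 u) \<subseteq> {A}"
      unfolding open_asms_sub_struct by auto
    moreover have "D' = sub_struct 0 u"
      using assms(3) D(1) by simp
    ultimately show ?thesis
      using D(1) by (auto intro!: complexity_less)
  qed
  then show ?thesis
    using assms(2) by (simp add: complexity_closed)
qed

text \<open>The recursion terminates because \<open>complexity\<close> decreases in the clause for non-atomic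
  conclusions, and because the clause for open structures leads to closed ones of no larger
  complexity.\<close>

declare conj_cong [fundef_cong]

function valid :: "'v arule set \<Rightarrow> 'v astruct \<Rightarrow> 'v reduction set \<Rightarrow> bool" where
  "valid \<BB> D \<JJ> \<longleftrightarrow>
     (if closed_struct D then
        (if concl D \<in> range Atom then
           (\<exists>D'. reduces \<JJ> D D' \<and> D' \<in> DER \<BB>)
         else
           (\<exists>D'. reduces \<JJ> D D' \<and> canonical D' \<and> (\<forall>D''\<in>set (immediate_subs D'). valid \<BB> D'' \<JJ>)))
      else
        (\<forall>\<sigma> \<JJ>'. is_subst \<sigma> \<longrightarrow> \<JJ> \<subseteq> \<JJ>' \<longrightarrow>
           (\<forall>A\<in>open_asms D. closed_struct (\<sigma> A)) \<longrightarrow> (\<forall>A\<in>open_asms D. valid \<BB> (\<sigma> A) \<JJ>') \<longrightarrow>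
           valid \<BB> (subst \<sigma> D) \<JJ>'))"
  by pat_completeness auto
termination
proof (relation "measure (\<lambda>(\<BB>, D, \<JJ>). 2 * complexity D + (if closed_struct D then 0 else 1))",
    goal_cases)
  case 1
  show ?case by simp
next
  case (2 \<BB> D \<JJ> D' D'')
  then have "concl D' = concl D" "closed_struct D'"
    using reduces_preserves[of \<JJ> D D'] by (auto simp: closed_struct_def)
  moreover from this 2 have "complexity D'' < complexity D'"
    by (intro complexity_immediate_sub) auto
  ultimately have "complexity D'' < complexity D"
    using 2 by (simp add: complexity_closed)
  then show ?case
    using 2 by simp
next
  case (3 \<BB> D \<JJ> \<sigma> \<JJ>' A)
  then have "complexity (\<sigma> A) \<le> complexity D"
    by (simp add: complexity_closed is_subst_def size_le_complexity)
  then show ?case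
    using 3 by simp
next
  case (4 \<BB> D \<JJ> \<sigma> \<JJ>')
  then have "closed_struct (subst \<sigma> D)"
    by (simp add: closed_struct_def open_asms_subst)
  moreover from this have "complexity (subst \<sigma> D) \<le> complexity D"
    using 4 by (simp add: complexity_closed concl_subst size_le_complexity)
  ultimately show ?case
    using 4 by simp
qed

declare conj_cong [fundef_cong del] valid.simps [simp del]

definition red_conseq :: "'v arule set \<Rightarrow> 'v fm set \<Rightarrow> 'v fm \<Rightarrow> bool" where
  "red_conseq \<BB> \<Gamma> A \<longleftrightarrow>
     (\<exists>D \<JJ>. arg_struct D \<and> open_asms D = \<Gamma> \<and> concl D = A \<and> valid \<BB> D \<JJ>)"

end

theory Submission
  imports Defs
begin

text \<open>
  Over a single base, standard consequence is classical: a conjunction, disjunction or implication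
  holds exactly when the corresponding truth-functional combination of its parts does. Reducibility
  semantics agrees because an argument may treat a valid closed argument for its conclusion, or the
  lack of one for an assumption, as a brute fact about the base. The core is
  \<open>base_sat_iff_closed_argument\<close>, an induction on \<open>A\<close> showing that \<open>A\<close> holds on \<open>\<BB>\<close> iff there is
  a valid closed argument for it. Neither half can be proved alone, since the antecedent of an
  implication needs the other one.

  From truth to arguments, the argument is built from introductions only. For a true implication
  there are two cases. If the consequent holds, its argument is prolonged by an introduction that
  discharges nothing. If the antecedent \<open>A\<close> fails, then by the induction hypothesis \<open>A\<close> has no valid
  closed argument under any set of reductions, so that an arbitrary step from \<open>A\<close> to the consequent
  is vacuously valid (\<open>closed_provable_Imp_refuted\<close>). No reduction is ever used, so by
  \<open>valid_mono\<close> these arguments are valid under all sets of reductions. This uniformity drives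
  the converse. A valid argument with true assumptions, under whatever reductions, can be closed by
  plugging in arguments for the assumptions that are valid under the same reductions
  (\<open>valid_open_closed_instance\<close>); for a canonical argument for an implication, this is applied to its
  immediate sub-structure.

  The same instantiation shows that reducibility consequence implies standard consequence.
  Conversely, given \<open>\<Gamma>\<close> and \<open>A\<close>, consider the one-step structure from \<open>\<Gamma>\<close> to \<open>A\<close>. If some member of
  \<open>\<Gamma>\<close> fails, it is vacuously valid. Otherwise \<open>A\<close> has a valid closed argument \<open>E\<close>, and it suffices to
  add one reduction that rewrites every such step with conclusion \<open>A\<close> to \<open>E\<close>. That function meets the
  conditions on reductions because \<open>E\<close>, being closed, is unaffected by substitution and has no
  assumptions to account for (\<open>is_reduction_const_red\<close>).
\<close>

section \<open>Argument structures under enlargement and substitution\<close>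

text \<open>An argument structure is its own sub-structure, and a sub-structure has lost all discharges
  that point outside. So a structure can be placed above any node without discharging
  anything there.\<close>

lemma outer_asms_sub_struct: "outer_asms n (sub_struct n t) \<subseteq> UNIV \<times> {None}"
proof (induction t arbitrary: n)
  case (Node A d ts)
  then show ?case
    by fastforce
qed (auto split: option.splits)

lemma outer_rules_sub_struct: "outer_rules n (sub_struct n t) = {}"
  by (induction t arbitrary: n) (auto split: option.splits)

lemma not_asm_mapped_sub_struct: "n \<le> k \<Longrightarrow> \<not> asm_mapped k (sub_struct n t)"
  by (induction t arbitrary: n k) (auto split: option.splits)

lemma arg_struct_outer:
  assumes "arg_struct t"
  shows "outer_asms 0 t \<subseteq> UNIV \<times> {None}" "outer_rules 0 t = {}" "\<not> asm_mapped k t"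
  using outer_asms_sub_struct[of 0 t] outer_rules_sub_struct[of 0 t]
    not_asm_mapped_sub_struct[of 0 k t] sub_struct_arg_struct[OF assms] by simp_all

lemma closed_arg_struct_outer_asms:
  assumes "arg_struct t" "closed_struct t"
  shows "outer_asms 0 t = {}"
  using arg_struct_outer(1)[OF assms(1)] assms(2) open_asms_iff[of _ t 0]
  by (fastforce simp: closed_struct_def)

text \<open>The discharges of \<open>t\<close> only look at the first \<open>length hs\<close> nodes below \<open>t\<close>, so further nodes
  may be added underneath.\<close>

lemma wf_struct_append: "wf_struct hs t \<Longrightarrow> wf_struct (hs @ hs') t"
proof (induction t arbitrary: hs)
  case (Node A d ts)
  let ?h = "\<exists>t\<in>set ts. asm_mapped 0 t"
  have "wf_struct (?h # hs @ hs') t" if "t \<in> set ts" for t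
    using Node.IH[OF that, of "?h # hs"] Node.prems that by (simp add: Let_def)
  then show ?case
    using Node.prems by (auto simp: Let_def nth_append)
qed auto

lemma wf_struct_of_arg_struct: "arg_struct t \<Longrightarrow> wf_struct hs t"
  using wf_struct_append[of "[]" t hs] by (simp add: arg_struct_def)

lemma arg_struct_Node: "(\<And>t. t \<in> set ts \<Longrightarrow> arg_struct t) \<Longrightarrow> arg_struct (Node A None ts)"
  by (simp add: arg_struct_def[of "Node A None ts"] Let_def wf_struct_of_arg_struct)

text \<open>The structures put in by \<open>\<sigma>\<close> are well-formed by themselves, hence map no assumption onto a
  node of the host. The side condition on discharged atomic rules is therefore not disturbed.\<close>

lemma asm_mapped_subst: "is_subst \<sigma> \<Longrightarrow> asm_mapped k (subst \<sigma> t) \<longleftrightarrow> asm_mapped k t"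
  by (induction t arbitrary: k) (auto simp: is_subst_def arg_struct_outer)

lemma wf_struct_subst: "is_subst \<sigma> \<Longrightarrow> wf_struct hs t \<Longrightarrow> wf_struct hs (subst \<sigma> t)"
proof (induction t arbitrary: hs)
  case (Asm A d)
  then show ?case
    by (auto simp: is_subst_def wf_struct_of_arg_struct)
next
  case (Node A d ts)
  let ?h = "\<exists>t\<in>set ts. asm_mapped 0 t"
  have "wf_struct (?h # hs) (subst \<sigma> t)" if "t \<in> set ts" for t
    using Node.IH[OF that, of "?h # hs"] Node.prems that by (simp add: Let_def)
  then show ?case
    using Node.prems by (auto simp: Let_def asm_mapped_subst concl_subst)
qed

lemma arg_struct_subst: "is_subst \<sigma> \<Longrightarrow> arg_struct t \<Longrightarrow> arg_struct (subst \<sigma> t)"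
  unfolding arg_struct_def by (rule wf_struct_subst)

lemma subst_closed_struct: "closed_struct t \<Longrightarrow> subst \<sigma> t = t"
  unfolding closed_struct_def by (induction t) (auto simp: map_idI split: if_splits)

lemma discharge_ext_refl: "discharge_ext t t"
  by (induction t) (auto intro!: discharge_ext.intros list.rel_refl_strong)

lemma inference_without_discharge:
  "(\<And>t. t \<in> set ts \<Longrightarrow> arg_struct t) \<Longrightarrow> (ts, A, ts) \<in> inferences"
  by (auto simp: inferences_def arg_struct_Node intro!: list.rel_refl_strong discharge_ext_refl)


section \<open>Validity and sets of reductions\<close>

lemma reduces_mono: "\<JJ> \<subseteq> \<JJ>' \<Longrightarrow> reduces \<JJ> D D' \<Longrightarrow> reduces \<JJ>' D D'"
proof -
  assume "\<JJ> \<subseteq> \<JJ>'"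
  then have "reduces1 \<JJ> \<le> reduces1 \<JJ>'"
    unfolding reduces1_def by blast
  then show "reduces \<JJ> D D' \<Longrightarrow> reduces \<JJ>' D D'"
    using rtranclp_mono by blast
qed

text \<open>The recursive equation for \<open>valid\<close>, split by cases so that it can be used for rewriting.\<close>

lemma valid_closed_atomic:
  "closed_struct D \<Longrightarrow> concl D \<in> range Atom \<Longrightarrow>
     valid \<BB> D \<JJ> \<longleftrightarrow> (\<exists>D'. reduces \<JJ> D D' \<and> D' \<in> DER \<BB>)"
  by (subst valid.simps) simp

lemma valid_closed_compound:
  "closed_struct D \<Longrightarrow> concl D \<notin> range Atom \<Longrightarrow>
     valid \<BB> D \<JJ> \<longleftrightarrow>
       (\<exists>D'. reduces \<JJ> D D' \<and> canonical D' \<and> (\<forall>D''\<in>set (immediate_subs D'). valid \<BB> D'' \<JJ>))"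
  by (subst valid.simps) simp

lemma valid_open:
  "\<not> closed_struct D \<Longrightarrow>
     valid \<BB> D \<JJ> \<longleftrightarrow>
       (\<forall>\<sigma> \<JJ>'. is_subst \<sigma> \<longrightarrow> \<JJ> \<subseteq> \<JJ>' \<longrightarrow>
          (\<forall>A\<in>open_asms D. closed_struct (\<sigma> A) \<and> valid \<BB> (\<sigma> A) \<JJ>') \<longrightarrow> valid \<BB> (subst \<sigma> D) \<JJ>')"
  by (subst valid.simps) (simp add: ball_conj_distrib imp_conjL)

text \<open>More reductions give more reduction sequences to closed structures, and validity of open
  structures quantifies over all extensions, of which there are fewer for a larger set.\<close>

lemma valid_mono: "valid \<BB> D \<JJ> \<Longrightarrow> \<JJ> \<subseteq> \<JJ>' \<Longrightarrow> valid \<BB> D \<JJ>'"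
proof (induction \<BB> D \<JJ> rule: valid.induct)
  case (1 \<BB> D \<JJ>)
  note red = reduces_mono[OF 1(5)]
  consider (atomic) "closed_struct D" "concl D \<in> range Atom"
    | (compound) "closed_struct D" "concl D \<notin> range Atom"
    | (opn) "\<not> closed_struct D"
    by blast
  then show ?case
  proof cases
    case atomic
    then show ?thesis
      using 1(4) red by (auto simp: valid_closed_atomic)
  next
    case compound
    then obtain D' where D': "reduces \<JJ> D D'" "canonical D'"
        "\<forall>D''\<in>set (immediate_subs D'). valid \<BB> D'' \<JJ>"
      using 1(4) by (auto simp: valid_closed_compound)
    have "valid \<BB> D'' \<JJ>'" if "D'' \<in> set (immediate_subs D')" for D''
      using 1(1)[OF compound D'(1,2) that] D'(3) that 1(5) by blast
    then show ?thesis
      using compound D'(2) red[OF D'(1)] by (auto simp: valid_closed_compound)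
  next
    case opn
    then show ?thesis
      using 1(4,5) unfolding valid_open[OF opn] by (meson subset_trans)
  qed
qed

lemma valid_closed_expansion:
  assumes "reduces \<JJ> D D'" "closed_struct D" "valid \<BB> D' \<JJ>"
  shows "valid \<BB> D \<JJ>"
proof -
  have D': "closed_struct D'" "concl D' = concl D"
    using reduces_preserves[OF assms(1)] assms(2) by (auto simp: closed_struct_def)
  note red = rtranclp_trans[OF assms(1)]
  show ?thesis
  proof (cases "concl D \<in> range Atom")
    case True
    then show ?thesis
      using assms(2,3) D' red by (auto simp: valid_closed_atomic)
  next
    case False
    then show ?thesis
      using assms(2,3) D' red valid_closed_compound by metis
  qed
qed

lemma valid_canonical:
  assumes "canonical D" "closed_struct D" "\<forall>D'\<in>set (immediate_subs D). valid \<BB> D' \<JJ>"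
  shows "valid \<BB> D \<JJ>"
proof -
  have "concl D \<notin> range Atom"
    using assms(1)
    by (auto simp: canonical_def and_intro_def or_intro_def imp_intro_def assoc_def)
  then show ?thesis
    using assms by (auto simp: valid_closed_compound)
qed


section \<open>Derivability by trees\<close>

text \<open>The discharge function can point at any node below, so a tree is compared with derivability
  from \<open>\<BB>\<close> together with all rules that are dischargeable at the nodes passed on the way up from the
  root.\<close>

lemma deriv_imp_derivable:
  "deriv \<BB> \<CC>s D \<Longrightarrow> concl D = Atom a \<Longrightarrow> derivable (\<BB> \<union> \<Union> (set \<CC>s)) a"
proof (induction arbitrary: a rule: deriv.induct)
  case (1 d ps a' \<CC>s ts)
  have "Rule ps a \<in> \<BB> \<union> \<Union> (set \<CC>s)"
    using 1(1,4) by (auto split: option.splits)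
  moreover have "derivable (\<BB> \<union> \<Union> (set \<CC>s) \<union> fset C) b" if "(C, b) \<in> set ps" for C b
  proof -
    obtain i where "i < length ps" "ps ! i = (C, b)"
      using \<open>(C, b) \<in> set ps\<close> by (auto simp: in_set_conv_nth)
    then show ?thesis
      using 1(3)[of i] by (simp add: Un_ac)
  qed
  ultimately show ?case
    by (rule derivable.intros)
qed

lemma derivable_imp_deriv:
  "derivable (\<BB> \<union> \<Union> (set \<CC>s)) a \<Longrightarrow> \<exists>D. deriv \<BB> \<CC>s D \<and> concl D = Atom a"
proof (induction "\<BB> \<union> \<Union> (set \<CC>s)" a arbitrary: \<CC>s rule: derivable.induct)
  case (1 ps a)
  have "\<exists>D. deriv \<BB> (fset (fst (ps ! i)) # \<CC>s) D \<and> concl D = Atom (snd (ps ! i))"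
    if "i < length ps" for i
    using that by (intro 1(3)[of "fst (ps ! i)"]) (auto simp: Un_ac)
  then obtain f where f: "\<And>i. i < length ps \<Longrightarrow>
      deriv \<BB> (fset (fst (ps ! i)) # \<CC>s) (f i) \<and> concl (f i) = Atom (snd (ps ! i))"
    by metis
  obtain d where "case d of None \<Rightarrow> Rule ps a \<in> \<BB> | Some k \<Rightarrow> k < length \<CC>s \<and> Rule ps a \<in> \<CC>s ! k"
  proof (cases "Rule ps a \<in> \<BB>")
    case True
    then show ?thesis using that[of None] by simp
  next
    case False
    then obtain k where "k < length \<CC>s" "Rule ps a \<in> \<CC>s ! k"
      using 1(1) by (auto simp: in_set_conv_nth)
    then show ?thesis using that[of "Some k"] by simp
  qed
  then have "deriv \<BB> \<CC>s (Node (Atom a) d (map f [0..<length ps]))"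
    using f by (intro deriv.intros) auto
  then show ?case
    by (intro exI[of _ "Node (Atom a) d (map f [0..<length ps])"]) simp
qed

text \<open>All top-nodes of a derivation are axiomatic. This makes it closed, and also makes it an argument
  structure, since the restriction on discharged atomic rules concerns only nodes onto which
  assumptions are mapped.\<close>

lemma deriv_no_asms:
  assumes "deriv \<BB> \<CC>s D"
  shows "\<not> asm_mapped k D" "open_asms D = {}" "concl D \<in> range Atom"
proof -
  have "(\<forall>k. \<not> asm_mapped k D) \<and> open_asms D = {} \<and> concl D \<in> range Atom"
    using assms by induction (fastforce simp: in_set_conv_nth)
  then show "\<not> asm_mapped k D" "open_asms D = {}" "concl D \<in> range Atom"
    by auto
qed

lemma deriv_wf_struct:
  "deriv \<BB> \<CC>s D \<Longrightarrow> length hs = length \<CC>s \<Longrightarrow> set hs \<subseteq> {False} \<Longrightarrow> wf_struct hs D"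
proof (induction arbitrary: hs rule: deriv.induct)
  case (1 d ps a \<CC>s ts)
  have no_asms: "(\<exists>t\<in>set ts. asm_mapped 0 t) = False"
    using 1(2,3) deriv_no_asms(1) by (fastforce simp: in_set_conv_nth)
  have "wf_struct (False # hs) t \<and> concl t \<in> range Atom" if "t \<in> set ts" for t
    using that 1(2-5) by (fastforce simp: in_set_conv_nth)
  moreover have "\<not> hs ! k" if "k < length hs" for k
    using nth_mem[OF that] 1(5) by auto
  ultimately show ?case
    using 1(1,4) unfolding wf_struct.simps no_asms by (auto split: option.splits)
qed

lemma DER_closed_arg_struct:
  assumes "D \<in> DER \<BB>"
  shows "arg_struct D" "closed_struct D"
  using assms deriv_wf_struct[of \<BB> "[]" D "[]"] deriv_no_asms(2)[of \<BB> "[]" D]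
  by (auto simp: DER_def arg_struct_def closed_struct_def)

lemma derivable_iff_DER: "derivable \<BB> a \<longleftrightarrow> (\<exists>D\<in>DER \<BB>. concl D = Atom a)"
  using derivable_imp_deriv[of \<BB> "[]" a] deriv_imp_derivable[of \<BB> "[]" _ a]
  by (auto simp: DER_def)


section \<open>Valid closed arguments built from introductions\<close>

text \<open>The empty set of reductions makes this the strongest form of provability by a closed argument:
  by \<open>valid_mono\<close> the same structure is valid under every set of reductions, so arguments for
  different formulas can be combined freely.\<close>

definition closed_provable :: "'v arule set \<Rightarrow> 'v fm \<Rightarrow> bool" where
  "closed_provable \<BB> A \<longleftrightarrow> (\<exists>D. arg_struct D \<and> closed_struct D \<and> concl D = A \<and> valid \<BB> D {})"

lemma closed_provable_Atom:
  assumes "derivable \<BB> a"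
  shows "closed_provable \<BB> (Atom a)"
proof -
  obtain D where D: "D \<in> DER \<BB>" "concl D = Atom a"
    using assms derivable_iff_DER by blast
  then have "valid \<BB> D {}"
    by (auto simp: valid_closed_atomic DER_closed_arg_struct)
  then show ?thesis
    using D DER_closed_arg_struct closed_provable_def by blast
qed

lemma closed_provable_canonical:
  assumes "canonical (Node A None ts)"
    and "\<And>t. t \<in> set ts \<Longrightarrow> arg_struct t \<and> closed_struct t \<and> valid \<BB> t {}"
  shows "closed_provable \<BB> A"
proof -
  have "valid \<BB> (Node A None ts) {}"
    using assms
    by (intro valid_canonical) (auto simp: closed_struct_def sub_struct_arg_struct)
  then show ?thesis
    unfolding closed_provable_def using assms(2)
    by (intro exI[of _ "Node A None ts"]) (auto simp: arg_struct_Node closed_struct_def)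
qed

lemma closed_provable_And:
  assumes "closed_provable \<BB> A" "closed_provable \<BB> B"
  shows "closed_provable \<BB> (And A B)"
proof -
  obtain D E where DE: "arg_struct D" "closed_struct D" "concl D = A" "valid \<BB> D {}"
      "arg_struct E" "closed_struct E" "concl E = B" "valid \<BB> E {}"
    using assms unfolding closed_provable_def by blast
  then have "([D, E], And A B, [D, E]) \<in> and_intro"
    unfolding and_intro_def using inference_without_discharge[of "[D, E]"] by auto
  then have "canonical (Node (And A B) None [D, E])"
    unfolding canonical_def by (force simp: assoc_def)
  then show ?thesis
    by (rule closed_provable_canonical) (use DE in auto)
qed

lemma closed_provable_Or:
  assumes "closed_provable \<BB> A \<or> closed_provable \<BB> B"
  shows "closed_provable \<BB> (Or A B)"
proof -
  obtain D where D: "arg_struct D" "closed_struct D" "concl D \<in> {A, B}" "valid \<BB> D {}"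
    using assms unfolding closed_provable_def by blast
  then have "([D], Or A B, [D]) \<in> or_intro"
    unfolding or_intro_def using inference_without_discharge[of "[D]"] by auto
  then have "canonical (Node (Or A B) None [D])"
    unfolding canonical_def by (force simp: assoc_def)
  then show ?thesis
    by (rule closed_provable_canonical) (use D in auto)
qed

lemma closed_provable_Imp_conclusion:
  assumes "closed_provable \<BB> B"
  shows "closed_provable \<BB> (Imp A B)"
proof -
  obtain D where D: "arg_struct D" "closed_struct D" "concl D = B" "valid \<BB> D {}"
    using assms unfolding closed_provable_def by blast
  then have "([D], Imp A B, [D]) \<in> imp_intro"
    unfolding imp_intro_def using inference_without_discharge[of "[D]"]
    by (auto simp: sub_struct_arg_struct closed_arg_struct_outer_asms arg_struct_outer)
  then have "canonical (Node (Imp A B) None [D])"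
    unfolding canonical_def by (force simp: assoc_def)
  then show ?thesis
    by (rule closed_provable_canonical) (use D in auto)
qed

text \<open>The step from \<open>A\<close> to \<open>B\<close> need not follow any known rule: being open, it is valid as soon as
  nothing can be substituted for \<open>A\<close>.\<close>

lemma closed_provable_Imp_refuted:
  assumes refuted: "\<And>D \<JJ>. closed_struct D \<Longrightarrow> concl D = A \<Longrightarrow> \<not> valid \<BB> D \<JJ>"
  shows "closed_provable \<BB> (Imp A B)"
proof -
  let ?S = "Node B None [Asm A None]"
  \<comment> \<open>The assumption lies two steps above the new root, which discharges it; hence the index 1.\<close>
  let ?u = "Node B None [Asm A (Some 1)]"
  let ?D = "Node (Imp A B) None [?u]"
  have "valid \<BB> ?S {}"
    using refuted by (subst valid_open) (auto simp: closed_struct_def is_subst_def)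
  moreover have "([?S], Imp A B, [?u]) \<in> imp_intro"
    by (auto simp: imp_intro_def inferences_def arg_struct_def Let_def intro!: discharge_ext.intros)
  then have "canonical ?D"
    unfolding canonical_def by (force simp: assoc_def)
  ultimately have "valid \<BB> ?D {}"
    by (intro valid_canonical) (auto simp: closed_struct_def)
  then show ?thesis
    unfolding closed_provable_def
    by (intro exI[of _ ?D]) (auto simp: closed_struct_def arg_struct_def Let_def)
qed


section \<open>Truth on a base and valid closed arguments\<close>

lemma canonical_cases [consumes 1, case_names And Or Imp]:
  assumes "canonical D"
  obtains (And) D1 D2 where "D = Node (And (concl D1) (concl D2)) None [D1, D2]"
      "arg_struct D1" "arg_struct D2"
    | (Or) E A B where "D = Node (Or A B) None [E]" "arg_struct E" "concl E \<in> {A, B}"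
    | (Imp) A u where "D = Node (Imp A (concl u)) None [u]"
      "outer_asms 0 u \<subseteq> {(A, Some 0)} \<union> UNIV \<times> {None}"
proof -
  consider "D \<in> assoc ` and_intro" | "D \<in> assoc ` or_intro" | "D \<in> assoc ` imp_intro"
    using assms by (auto simp: canonical_def)
  then show thesis
  proof cases
    case 1
    then show ?thesis
      using And by (auto simp: and_intro_def inferences_def assoc_def)
  next
    case 2
    then show ?thesis
      using Or by (auto simp: or_intro_def inferences_def assoc_def)
  next
    case 3
    then obtain D' A u where *: "D = Node (Imp A (concl D')) None [u]" "sub_struct 0 u = D'"
        "outer_asms 0 u \<subseteq> {(A, Some 0)} \<union> UNIV \<times> {None}"
      by (force simp: imp_intro_def assoc_def)
    then have "concl D' = concl u"
      by auto
    then show ?thesis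
      using Imp * by auto
  qed
qed

lemma valid_closed_canonicalE:
  assumes "valid \<BB> D \<JJ>" "closed_struct D" "concl D \<notin> range Atom"
  obtains D' where "canonical D'" "closed_struct D'" "concl D' = concl D"
    "\<And>D''. D'' \<in> set (immediate_subs D') \<Longrightarrow> valid \<BB> D'' \<JJ>"
proof -
  obtain D' where D': "reduces \<JJ> D D'" "canonical D'"
      "\<forall>D''\<in>set (immediate_subs D'). valid \<BB> D'' \<JJ>"
    using assms by (auto simp: valid_closed_compound)
  moreover have "closed_struct D'" "concl D' = concl D"
    using reduces_preserves[OF D'(1)] assms(2) by (auto simp: closed_struct_def)
  ultimately show ?thesis
    using that by blast
qed

text \<open>Modus ponens for validity. A closed argument is its own instance, which covers introductions of
  implications that discharge nothing.\<close>

lemma valid_open_closed_instance: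
  assumes D: "valid \<BB> D \<JJ>" and prov: "\<And>B. B \<in> open_asms D \<Longrightarrow> closed_provable \<BB> B"
  obtains E where "closed_struct E" "concl E = concl D" "valid \<BB> E \<JJ>"
proof (cases "closed_struct D")
  case True
  then show ?thesis using that D by blast
next
  case False
  \<comment> \<open>A substitution is total; on formulas outside \<open>open_asms D\<close> the assumption itself serves as value.\<close>
  define \<sigma> where "\<sigma> B = (if closed_provable \<BB> B
      then SOME E. arg_struct E \<and> closed_struct E \<and> concl E = B \<and> valid \<BB> E {}
      else Asm B None)" for B
  have \<sigma>: "arg_struct (\<sigma> B) \<and> closed_struct (\<sigma> B) \<and> concl (\<sigma> B) = B \<and> valid \<BB> (\<sigma> B) {}"
    if "closed_provable \<BB> B" for B
    using that someI_ex[of "\<lambda>E. arg_struct E \<and> closed_struct E \<and> concl E = B \<and> valid \<BB> E {}"]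
    by (simp add: \<sigma>_def closed_provable_def)
  have "arg_struct (\<sigma> B) \<and> concl (\<sigma> B) = B" for B
    using \<sigma>[of B] by (cases "closed_provable \<BB> B") (auto simp: \<sigma>_def arg_struct_def)
  then have "is_subst \<sigma>"
    by (simp add: is_subst_def)
  moreover have "closed_struct (\<sigma> B) \<and> valid \<BB> (\<sigma> B) \<JJ>" if "B \<in> open_asms D" for B
    using \<sigma>[OF prov[OF that]] valid_mono[of \<BB> "\<sigma> B" "{}" \<JJ>] by auto
  ultimately have "closed_struct (subst \<sigma> D)" "concl (subst \<sigma> D) = concl D" "valid \<BB> (subst \<sigma> D) \<JJ>"
    using D unfolding valid_open[OF False]
    by (auto simp: closed_struct_def open_asms_subst concl_subst)
  then show ?thesis
    using that by blast
qed

text \<open>The two halves differ in strength: arguments are produced for the empty set of reductions, but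
  truth is extracted from validity under any set. The stronger forms are what makes the induction
  go through at implications, where the argument for the antecedent has to be valid under the
  given reductions, and where failure of the antecedent has to exclude arguments under all
  extensions.\<close>

lemma base_sat_iff_closed_argument:
  "(base_sat \<BB> A \<longrightarrow> closed_provable \<BB> A) \<and>
   (\<forall>D \<JJ>. closed_struct D \<longrightarrow> concl D = A \<longrightarrow> valid \<BB> D \<JJ> \<longrightarrow> base_sat \<BB> A)"
proof (induction A)
  case (Atom a)
  have "derivable \<BB> a" if D: "closed_struct D" "concl D = Atom a" "valid \<BB> D \<JJ>" for D \<JJ>
  proof -
    obtain D' where "reduces \<JJ> D D'" "D' \<in> DER \<BB>"
      using D by (auto simp: valid_closed_atomic)
    then show ?thesis
      using D(2) reduces_preserves(1) derivable_iff_DER by metis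
  qed
  then show ?case
    by (auto intro: closed_provable_Atom)
next
  case (And A B)
  have "base_sat \<BB> (And A B)"
    if D: "closed_struct D" "concl D = And A B" "valid \<BB> D \<JJ>" for D \<JJ>
  proof -
    obtain D' where D': "canonical D'" "closed_struct D'" "concl D' = And A B"
      "\<And>D''. D'' \<in> set (immediate_subs D') \<Longrightarrow> valid \<BB> D'' \<JJ>"
      using valid_closed_canonicalE[OF D(3,1)] D(2) by auto
    from D'(1) show ?thesis
    proof (cases rule: canonical_cases)
      case (And D1 D2)
      then have "closed_struct D1" "closed_struct D2" "valid \<BB> D1 \<JJ>" "valid \<BB> D2 \<JJ>"
          "concl D1 = A" "concl D2 = B"
        using D'(2-4) by (simp_all add: closed_struct_def sub_struct_arg_struct)
      then show ?thesis
        using And.IH by (metis base_sat.simps(2))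
    qed (use D'(3) in auto)
  qed
  then show ?case
    using And.IH closed_provable_And by (metis base_sat.simps(2))
next
  case (Or A B)
  have "base_sat \<BB> (Or A B)"
    if D: "closed_struct D" "concl D = Or A B" "valid \<BB> D \<JJ>" for D \<JJ>
  proof -
    obtain D' where D': "canonical D'" "closed_struct D'" "concl D' = Or A B"
      "\<And>D''. D'' \<in> set (immediate_subs D') \<Longrightarrow> valid \<BB> D'' \<JJ>"
      using valid_closed_canonicalE[OF D(3,1)] D(2) by auto
    from D'(1) show ?thesis
    proof (cases rule: canonical_cases)
      case (Or E A' B')
      then have "closed_struct E" "valid \<BB> E \<JJ>" "concl E = A \<or> concl E = B"
        using D'(2-4) by (auto simp: closed_struct_def sub_struct_arg_struct)
      then show ?thesis
        using Or.IH by (metis base_sat.simps(3))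
    qed (use D'(3) in auto)
  qed
  then show ?case
    using Or.IH closed_provable_Or by (metis base_sat.simps(3))
next
  case (Imp A B)
  have "base_sat \<BB> B"
    if D: "closed_struct D" "concl D = Imp A B" "valid \<BB> D \<JJ>" and A: "base_sat \<BB> A" for D \<JJ>
  proof -
    obtain D' where D': "canonical D'" "closed_struct D'" "concl D' = Imp A B"
      "\<And>D''. D'' \<in> set (immediate_subs D') \<Longrightarrow> valid \<BB> D'' \<JJ>"
      using valid_closed_canonicalE[OF D(3,1)] D(2) by auto
    from D'(1) show ?thesis
    proof (cases rule: canonical_cases)
      case (Imp A' u)
      have "open_asms u = {}"
        using D'(2) Imp(1) by (simp add: closed_struct_def)
      then have "open_asms (sub_struct 0 u) \<subseteq> {A}"
        using D'(3) Imp open_asms_iff[of _ u 0] by (fastforce simp: open_asms_sub_struct)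
      moreover have "valid \<BB> (sub_struct 0 u) \<JJ>"
        using D'(4) Imp(1) by simp
      ultimately obtain E where "closed_struct E" "concl E = concl (sub_struct 0 u)" "valid \<BB> E \<JJ>"
        using valid_open_closed_instance[of \<BB> "sub_struct 0 u" \<JJ>] A Imp.IH(1) by blast
      then show ?thesis
        using Imp.IH(2) D'(3) Imp(1) by (metis concl.simps(2) concl_sub_struct fm.inject(4))
    qed (use D'(3) in auto)
  qed
  moreover have "closed_provable \<BB> (Imp A B)" if "base_sat \<BB> (Imp A B)"
  proof (cases "base_sat \<BB> A")
    case True
    then show ?thesis
      \<comment> \<open>Then \<open>B\<close> holds too, and an argument for it needs no assumption.\<close>
      using that Imp.IH(2) closed_provable_Imp_conclusion by auto
  next
    case False
    then show ?thesis
      using Imp.IH(1) closed_provable_Imp_refuted by blast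
  qed
  ultimately show ?case
    by auto
qed

lemma base_sat_imp_closed_provable: "base_sat \<BB> A \<Longrightarrow> closed_provable \<BB> A"
  using base_sat_iff_closed_argument by blast

lemma valid_closed_imp_base_sat: "closed_struct D \<Longrightarrow> valid \<BB> D \<JJ> \<Longrightarrow> base_sat \<BB> (concl D)"
  using base_sat_iff_closed_argument by blast


section \<open>A reduction to a fixed closed structure\<close>

text \<open>The premises are arbitrary structures because the domain of a reduction is closed under
  substitution.\<close>

definition const_red :: "'v astruct \<Rightarrow> 'v astruct \<rightharpoonup> 'v astruct" where
  "const_red E D = (if \<exists>ts. D = Node (concl E) None ts \<and> (\<forall>t\<in>set ts. arg_struct t)
     then Some E else None)"

lemma is_reduction_const_red:
  assumes "arg_struct E" "closed_struct E"
  shows "is_reduction (const_red E)"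
proof -
  let ?R = "{(ts, concl E, ts) |ts. \<forall>t\<in>set ts. arg_struct t}"
  have R: "assoc ` ?R = {Node (concl E) None ts |ts. \<forall>t\<in>set ts. arg_struct t}"
    by (force simp: assoc_def)
  have val: "const_red E D = Some E" if "D \<in> assoc ` ?R" for D
    using that unfolding R by (auto simp: const_red_def)
  have "dom (const_red E) = assoc ` ?R"
    unfolding R by (auto simp: const_red_def split: if_splits)
  moreover have "\<forall>D\<in>assoc ` ?R. arg_struct (the (const_red E D)) \<and>
      open_asms (the (const_red E D)) \<subseteq> open_asms D \<and> concl (the (const_red E D)) = concl D \<and>
      (\<forall>\<sigma>. is_subst \<sigma> \<longrightarrow> subst \<sigma> D \<in> assoc ` ?R \<and>
         const_red E (subst \<sigma> D) = Some (subst \<sigma> (the (const_red E D))))"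
  proof
    fix D assume D: "D \<in> assoc ` ?R"
    have subst_D: "subst \<sigma> D \<in> assoc ` ?R" if "is_subst \<sigma>" for \<sigma>
      using that D unfolding R by (auto simp: arg_struct_subst)
    have "concl E = concl D"
      using D unfolding R by auto
    moreover have "open_asms E = {}"
      using assms(2) by (simp add: closed_struct_def)
    ultimately show "arg_struct (the (const_red E D)) \<and>
      open_asms (the (const_red E D)) \<subseteq> open_asms D \<and> concl (the (const_red E D)) = concl D \<and>
      (\<forall>\<sigma>. is_subst \<sigma> \<longrightarrow> subst \<sigma> D \<in> assoc ` ?R \<and>
         const_red E (subst \<sigma> D) = Some (subst \<sigma> (the (const_red E D))))"
      unfolding val[OF D] option.sel subst_closed_struct[OF assms(2)]
      using subst_D val assms(1) by blast
  qed
  ultimately have "reduction_for ?R (const_red E)"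
    unfolding reduction_for_def by (intro exI[of _ ?R] conjI subset_refl)
  moreover have "?R \<subseteq> inferences"
    using inference_without_discharge by (clarify, blast)
  ultimately show ?thesis
    unfolding is_reduction_def by (intro exI[of _ ?R] conjI)
qed

lemma reduces1_const_red:
  assumes "arg_struct E" "closed_struct E" "\<And>t. t \<in> set ts \<Longrightarrow> arg_struct t"
    and "Abs_reduction (const_red E) \<in> \<JJ>"
  shows "reduces1 \<JJ> (Node (concl E) None ts) E"
proof -
  let ?D = "Node (concl E) None ts"
  have "apply_red (Abs_reduction (const_red E)) ?D = Some E"
    using assms(3) is_reduction_const_red[OF assms(1,2)]
    by (simp add: Abs_reduction_inverse) (simp add: const_red_def)
  moreover have "replaced ?D E ?D E"
    using assms(1,2,3)
    by (intro replaced.here)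
       (simp_all del: sub_struct.simps add: sub_struct_arg_struct arg_struct_Node closed_arg_struct_outer_asms
         arg_struct_outer)
  ultimately show ?thesis
    unfolding reduces1_def using assms(1,4) by blast
qed

section \<open>Equivalence of the two consequence relations\<close>

text \<open>A constant reduction is what lets the assumptions \<open>\<Gamma>\<close> occur at all: the argument must be from
  exactly \<open>\<Gamma>\<close>, while the argument for \<open>A\<close> that its closed instances have to reduce to may have
  nothing to do with \<open>\<Gamma>\<close>.\<close>

lemma base_conseq_imp_red_conseq:
  assumes "finite \<Gamma>" and conseq: "base_conseq \<BB> \<Gamma> A"
  shows "red_conseq \<BB> \<Gamma> A"
proof (cases "\<Gamma> = {}")
  case True
  then have "closed_provable \<BB> A"
    using conseq base_sat_imp_closed_provable by (simp add: base_conseq_def)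
  then show ?thesis
    using True unfolding closed_provable_def red_conseq_def closed_struct_def by blast
next
  case nonempty: False
  obtain Bs where Bs: "set Bs = \<Gamma>"
    using finite_list[OF assms(1)] by blast
  define D where "D = Node A None (map (\<lambda>B. Asm B None) Bs)"
  have D: "arg_struct D" "open_asms D = \<Gamma>" "concl D = A"
    using Bs by (auto simp: D_def arg_struct_def Let_def)
  then have open_D: "\<not> closed_struct D"
    using nonempty by (simp add: closed_struct_def)
  have "\<exists>\<JJ>. valid \<BB> D \<JJ>"
  proof (cases "\<forall>B\<in>\<Gamma>. base_sat \<BB> B")
    case True
    then have "closed_provable \<BB> A"
      using conseq nonempty base_sat_imp_closed_provable by (auto simp: base_conseq_def)
    then obtain E where E: "arg_struct E" "closed_struct E" "concl E = A" "valid \<BB> E {}"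
      unfolding closed_provable_def by blast
    let ?\<JJ> = "{Abs_reduction (const_red E)}"
    have "valid \<BB> (subst \<sigma> D) \<JJ>'"
      if "is_subst \<sigma>" "?\<JJ> \<subseteq> \<JJ>'" "\<forall>B\<in>open_asms D. closed_struct (\<sigma> B)" for \<sigma> \<JJ>'
    proof (rule valid_closed_expansion)
      show "valid \<BB> E \<JJ>'"
        using valid_mono[OF E(4)] by simp
      show "closed_struct (subst \<sigma> D)"
        using that(3) by (simp add: closed_struct_def open_asms_subst)
      have "reduces1 \<JJ>' (Node (concl E) None (map \<sigma> Bs)) E"
        using that(1,2) by (intro reduces1_const_red E(1,2)) (auto simp: is_subst_def)
      then show "reduces \<JJ>' (subst \<sigma> D) E"
        by (simp add: D_def E(3) comp_def)
    qed
    then have "valid \<BB> D ?\<JJ>"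
      unfolding valid_open[OF open_D] by blast
    then show ?thesis ..
  next
    case False
    then have "valid \<BB> D {}"
      unfolding valid_open[OF open_D] D(2) is_subst_def using valid_closed_imp_base_sat by metis
    then show ?thesis ..
  qed
  then show ?thesis
    using D unfolding red_conseq_def by blast
qed

lemma red_conseq_imp_base_conseq:
  assumes "red_conseq \<BB> \<Gamma> A"
  shows "base_conseq \<BB> \<Gamma> A"
proof -
  obtain D \<JJ> where D: "open_asms D = \<Gamma>" "concl D = A" "valid \<BB> D \<JJ>"
    using assms unfolding red_conseq_def by blast
  have "base_sat \<BB> A" if "\<forall>B\<in>\<Gamma>. base_sat \<BB> B"
  proof -
    have "closed_provable \<BB> B" if "B \<in> open_asms D" for B
      using \<open>\<forall>B\<in>\<Gamma>. base_sat \<BB> B\<close> that D(1) base_sat_imp_closed_provable by blast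
    then obtain E where "closed_struct E" "concl E = concl D" "valid \<BB> E \<JJ>"
      using valid_open_closed_instance[OF D(3)] by metis
    then show ?thesis
      using valid_closed_imp_base_sat D(2) by metis
  qed
  then show ?thesis
    by (simp add: base_conseq_def)
qed

theorem theorem1:
  fixes \<BB> :: "'v arule set" and \<Gamma> :: "'v fm set" and A :: "'v fm"
  assumes "atomic_base \<BB>" and "finite \<Gamma>"
  shows "base_conseq \<BB> \<Gamma> A \<longleftrightarrow> red_conseq \<BB> \<Gamma> A"
  using base_conseq_imp_red_conseq[OF assms(2)] red_conseq_imp_base_conseq by blast

end
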